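(* Let $\hat{\mathbf v}:\mathbb R^3\times\mathrm{Lin}\times\mathcal V\to\mathcal V$ and $\hat\tau:\mathbb R^3\times\mathrm{Lin}\times\mathcal V\to\mathbb R$ be the constitutive mappings for velocity and total energy, functions of $(x,\mathbf F,\mathbf p)$, with $\hat{\mathbf v}$ continuously differentiable and normal, and with $\hat{\mathbf v}=\partial_{\mathbf p}\hat\tau$ (thermodynamic admissibility). Suppose that $\hat{\mathbf v}$ satisfies the Galilean variance requirement (G) and $\hat\tau$ satisfies the parity requirement (P) of the context. Then $\hat{\mathbf v}$ has the representation $$\hat{\mathbf v}(x,\mathbf F,\mathbf p)=\mathbf V\mathbf p\qquad\text{for all }(\mathbf F,\mathbf p)\in\mathrm{Lin}\times\mathcal V,$$ where the symmetric and invertible tensor $\mathbf V$ depends at most on $x$.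
   Context: Vectors are elements of $\mathcal V=\mathbb R^3$ with the Euclidean inner product; tensors are linear maps of $\mathcal V$ into itself, forming the space $\mathrm{Lin}$. The constitutive mappings may depend explicitly on the point $x\in\mathbb R^3$ but not on time. Normality of $\hat{\mathbf v}$: the matrix $N_{ih}=\partial_{p_h}\hat v_i(x,\mathbf F,\mathbf p)$ is invertible for all $(x,\mathbf F,\mathbf p)$. (G) Galilean variance of velocity: for each $x$ there is a mapping $\hat{\mathbf c}_{\mathbf v}:\mathcal V\to\mathcal V$ (the same for all $(\mathbf F,\mathbf p)$) such that $\hat{\mathbf v}(x,\mathbf F,\mathbf p+\mathbf d)-\hat{\mathbf v}(x,\mathbf F,\mathbf p)=\hat{\mathbf c}_{\mathbf v}(\mathbf d)$ for all tensors $\mathbf F$ and all vectors $\mathbf p,\mathbf d$. (P) Parity of total energy with respect to momentum: $\hat\tau(x,\mathbf F,\mathbf p)=\hat\tau(x,\mathbf F,-\mathbf p)$ for all $(x,\mathbf F,\mathbf p)$. *)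

theory Defs
  imports "HOL-Analysis.Analysis"
begin

text \<open>Tensors, i.e. linear maps of \<open>\<real>\<^sup>3\<close> into itself, are represented by their matrices in the
  standard orthonormal basis, so that the symmetric tensors are those with \<open>transpose V = V\<close>.\<close>

type_synonym vec3 = "real^3"
type_synonym tensor = "real^3^3"
type_synonym state = "vec3 \<times> tensor \<times> vec3"  \<comment> \<open>\<open>(x, F, p)\<close>\<close>

definition cont_differentiable :: "('a::real_normed_vector \<Rightarrow> 'b::real_normed_vector) \<Rightarrow> bool" where
  "cont_differentiable f \<longleftrightarrow>
     (\<exists>f' :: 'a \<Rightarrow> 'a \<Rightarrow>\<^sub>L 'b.
        (\<forall>z. (f has_derivative blinfun_apply (f' z)) (at z)) \<and> continuous_on UNIV f')"

text \<open>The entry \<open>(i, h)\<close> of the Jacobian matrix below is the partial derivative of the \<open>i\<close>-th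
  component of \<open>v\<close> with respect to the \<open>h\<close>-th component of \<open>p\<close>. It is meaningful only where \<open>v\<close>
  is differentiable in \<open>p\<close>.\<close>

definition normal_velocity :: "(state \<Rightarrow> vec3) \<Rightarrow> bool" where
  "normal_velocity v \<longleftrightarrow> (\<forall>x F p. invertible (jacobian (\<lambda>q. v (x, F, q)) (at p)))"

text \<open>\<open>v\<close> is the partial gradient of \<open>\<tau>\<close> with respect to \<open>p\<close>; this includes that \<open>\<tau>\<close> is
  differentiable in \<open>p\<close>.\<close>

definition thermo_admissible :: "(state \<Rightarrow> vec3) \<Rightarrow> (state \<Rightarrow> real) \<Rightarrow> bool" where
  "thermo_admissible v \<tau> \<longleftrightarrow> (\<forall>x F p. GDERIV (\<lambda>q. \<tau> (x, F, q)) p :> v (x, F, p))"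

definition galilean_variance :: "(state \<Rightarrow> vec3) \<Rightarrow> bool" where
  "galilean_variance v \<longleftrightarrow>
     (\<forall>x. \<exists>c :: vec3 \<Rightarrow> vec3. \<forall>F p d. v (x, F, p + d) - v (x, F, p) = c d)"

definition momentum_parity :: "(state \<Rightarrow> real) \<Rightarrow> bool" where
  "momentum_parity \<tau> \<longleftrightarrow> (\<forall>x F p. \<tau> (x, F, p) = \<tau> (x, F, - p))"

end

theory Submission
  imports Defs
begin

text \<open>Parity makes \<open>v\<close> odd in \<open>p\<close>, so \<open>v\<close> vanishes at \<open>p = 0\<close>; variance at \<open>p = 0\<close>
  then identifies \<open>v (x, F, d)\<close> with the increment \<open>c d\<close>, which is independent of \<open>F\<close> and additive
  in \<open>d\<close>. A differentiable additive map is linear, and normality is invertibility of its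
  matrix. Integrating along rays, the potential of a linear gradient \<open>V p\<close> is
  \<open>V p \<bullet> p / 2\<close> up to a constant; the gradient of the latter is the symmetric part of \<open>V\<close>
  applied to \<open>p\<close>, whence \<open>V\<close> is symmetric.\<close>

text \<open>By evenness \<open>f\<close> coincides with its composite with negation, whose gradient
  at \<open>p\<close> is \<open>- g (- p)\<close> by the chain rule; gradients are unique.\<close>

lemma GDERIV_even_imp_odd:
  fixes f :: "'a::real_inner \<Rightarrow> real"
  assumes "\<And>p. f (- p) = f p" and grad: "\<And>p. GDERIV f p :> g p"
  shows "g (- p) = - g p"
proof -
  have "((\<lambda>q. f (- q)) has_derivative (\<lambda>h. - h \<bullet> g (- p))) (at p)"
    using has_derivative_compose[OF has_derivative_minus[OF has_derivative_ident] grad[unfolded gderiv_def]]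
    by simp
  then have "GDERIV f p :> - g (- p)"
    unfolding gderiv_def using assms(1) by simp
  then have "(\<lambda>h. h \<bullet> - g (- p)) = (\<lambda>h. h \<bullet> g p)"
    using grad[of p] unfolding gderiv_def by (rule has_derivative_unique)
  then have "- g (- p) = g p"
    using vector_eq_ldot by metis
  then show ?thesis
    by (metis minus_minus)
qed

text \<open>Additivity carries the derivative \<open>D\<close> at 0 unchanged to every point. Hence
  \<open>f - D\<close> has zero derivative everywhere, so it is constant, and its value at 0 is
  0.\<close>

lemma differentiable_additive_imp_linear:
  fixes f :: "'a::real_normed_vector \<Rightarrow> 'b::real_normed_vector"
  assumes add: "\<And>p d. f (p + d) = f p + f d" and diff: "f differentiable at 0"
  shows "linear f"
proof -
  have f0: "f 0 = 0"
    using add[of 0 0] by simp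
  from diff obtain D where D: "(f has_derivative D) (at 0)"
    by (auto simp: differentiable_def)
  have everywhere: "(f has_derivative D) (at p)" for p
  proof -
    have "((\<lambda>q. q - p) has_derivative (\<lambda>h. h)) (at p)"
      by (auto intro!: derivative_eq_intros)
    then have "((\<lambda>q. f (q - p)) has_derivative D) (at p)"
      using has_derivative_compose[of "\<lambda>q. q - p" "\<lambda>h. h" p UNIV f D] D by simp
    \<comment> \<open>This function of \<open>q\<close> is \<open>f\<close> itself, by
      additivity.\<close>
    then have "((\<lambda>q. f p + f (q - p)) has_derivative D) (at p)"
      by (auto intro!: derivative_eq_intros)
    then show ?thesis
      by (simp flip: add)
  qed
  have "bounded_linear D"
    using D by (rule has_derivative_bounded_linear)
  then have "((\<lambda>q. f q - D q) has_derivative (\<lambda>h. 0)) (at p)" for p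
    using has_derivative_diff[OF everywhere bounded_linear_imp_has_derivative[of D]] by simp
  then have "\<exists>c. \<forall>p\<in>UNIV. f p - D p = c"
    by (intro has_derivative_zero_constant) (auto simp: has_derivative_at_withinI)
  then have "f p - D p = f 0 - D 0" for p
    by auto
  then have "f = D"
    using f0 linear_0[OF bounded_linear.linear[OF \<open>bounded_linear D\<close>]] by auto
  then show ?thesis
    using \<open>bounded_linear D\<close> bounded_linear.linear by blast
qed

text \<open>By linearity of \<open>g\<close>, the derivative of \<open>f\<close> along the ray
  through \<open>p\<close> is \<open>t * (g p \<bullet> p)\<close>. Subtracting its primitive leaves
  a function constant in \<open>t\<close>, compared at 1 and 0.\<close>

lemma GDERIV_linear_imp_quadratic:
  fixes f :: "'a::real_inner \<Rightarrow> real"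
  assumes "linear g" and grad: "\<And>p. GDERIV f p :> g p"
  shows "f p = f 0 + (g p \<bullet> p) / 2"
proof -
  have "((\<lambda>t. f (t *\<^sub>R p) - t\<^sup>2 / 2 * (g p \<bullet> p)) has_real_derivative 0) (at t)" for t
  proof -
    have "((\<lambda>t. t *\<^sub>R p) has_derivative (\<lambda>h. h *\<^sub>R p)) (at t)"
      by (auto intro!: derivative_eq_intros)
    from has_derivative_compose[OF this grad[unfolded gderiv_def]]
    have "((\<lambda>t. f (t *\<^sub>R p)) has_real_derivative t * (g p \<bullet> p)) (at t)"
      unfolding has_field_derivative_def
      by (rule has_derivative_eq_rhs)
        (simp add: fun_eq_iff linear_scale[OF \<open>linear g\<close>] inner_commute)
    then show ?thesis
      by (auto intro!: derivative_eq_intros)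
  qed
  from DERIV_isconst_all[of _ 1 0, OF allI[OF this]] show ?thesis
    by simp
qed

text \<open>Differentiating the quadratic form of \<open>f\<close> in direction \<open>q\<close>
  gives \<open>(g p \<bullet> q + g q \<bullet> p) / 2\<close>. This must equal
  \<open>q \<bullet> g p\<close>, so the two summands agree.\<close>

lemma GDERIV_linear_imp_self_adjoint:
  fixes f :: "'a::real_inner \<Rightarrow> real"
  assumes "bounded_linear g" and grad: "\<And>p. GDERIV f p :> g p"
  shows "g p \<bullet> q = p \<bullet> g q"
proof -
  have quadratic: "f p = f 0 + (g p \<bullet> p) / 2" for p
    using GDERIV_linear_imp_quadratic[OF bounded_linear.linear[OF assms(1)] grad] .
  have "((\<lambda>p. g p \<bullet> p) has_derivative (\<lambda>h. g p \<bullet> h + g h \<bullet> p)) (at p)"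
    using assms(1) by (intro has_derivative_inner bounded_linear_imp_has_derivative has_derivative_ident)
  then have "((\<lambda>p. f 0 + (g p \<bullet> p) / 2) has_derivative
      (\<lambda>h. 0 + (g p \<bullet> h + g h \<bullet> p) / 2)) (at p)"
    by (intro has_derivative_add has_derivative_const
        bounded_linear.has_derivative[OF bounded_linear_divide])
  then have "(f has_derivative (\<lambda>h. 0 + (g p \<bullet> h + g h \<bullet> p) / 2)) (at p)"
    by (simp only: quadratic[symmetric])
  then have "(\<lambda>h. 0 + (g p \<bullet> h + g h \<bullet> p) / 2) = (\<lambda>h. h \<bullet> g p)"
    using grad[of p] unfolding gderiv_def by (rule has_derivative_unique)
  from fun_cong[OF this, of q] show ?thesis
    by (simp add: inner_commute)
qed

theorem proposition3:
  fixes v :: "(real^3) \<times> (real^3^3) \<times> (real^3) \<Rightarrow> real^3"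
    and \<tau> :: "(real^3) \<times> (real^3^3) \<times> (real^3) \<Rightarrow> real"
  assumes "cont_differentiable v"
    and "normal_velocity v"
    and "thermo_admissible v \<tau>"
    and "galilean_variance v"
    and "momentum_parity \<tau>"
  shows "\<exists>V :: real^3 \<Rightarrow> real^3^3.
           \<forall>x. transpose (V x) = V x \<and> invertible (V x) \<and>
               (\<forall>F p. v (x, F, p) = V x *v p)"
\<comment> \<open>It suffices to find a matrix for each fixed \<open>x\<close>;
  \<open>choice\<close> assembles these into the function \<open>V\<close>.\<close>
proof (intro choice allI)
  fix x
  have grad: "GDERIV (\<lambda>q. \<tau> (x, F, q)) p :> v (x, F, p)" for F p
    using assms(3) by (simp add: thermo_admissible_def)
  have even: "\<tau> (x, F, - p) = \<tau> (x, F, p)" for F p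
    using assms(5) by (metis momentum_parity_def)
  have v0: "v (x, F, 0) = 0" for F
  proof -
    have "v (x, F, 0) = - v (x, F, 0)"
      using GDERIV_even_imp_odd[of "\<lambda>q. \<tau> (x, F, q)", OF even grad, of 0] by (simp only: minus_zero)
    then have "2 *\<^sub>R v (x, F, 0) = 0"
      unfolding scaleR_2 eq_neg_iff_add_eq_0 .
    then show ?thesis
      by simp
  qed
  \<comment> \<open>A single \<open>c\<close> serves every \<open>F\<close>, so the tensor 0 can
    stand for an arbitrary one below.\<close>
  obtain c where c: "v (x, F, p + d) - v (x, F, p) = c d" for F p d
    using assms(4) unfolding galilean_variance_def by blast
  have vc: "v (x, F, p) = c p" for F p
    using c[of F 0 p] v0 by simp
  have additive: "c (p + d) = c p + c d" for p d
    using c[of 0 p d] by (simp add: vc algebra_simps)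
  have "c differentiable at 0"
  proof -
    obtain D where "(v has_derivative D) (at (x, 0, 0))"
      using assms(1) unfolding cont_differentiable_def by blast
    moreover have "((\<lambda>p. (x, 0, p)) has_derivative (\<lambda>h. (0, 0, h))) (at 0)"
      by (auto intro!: derivative_eq_intros)
    ultimately have "((\<lambda>p. v (x, 0, p)) has_derivative (\<lambda>h. D (0, 0, h))) (at 0)"
      using has_derivative_compose by fastforce
    then show ?thesis
      by (auto simp: vc differentiable_def)
  qed
  with additive have lin: "linear c"
    by (rule differentiable_additive_imp_linear)
  have mat: "matrix c *v p = c p" for p
    using lin by (simp add: matrix_works)
  have "c p \<bullet> q = p \<bullet> c q" for p q
    using GDERIV_linear_imp_self_adjoint[of c "\<lambda>q. \<tau> (x, 0, q)"] grad lin
    by (simp add: vc linear_conv_bounded_linear)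
  then have "adjoint c = c"
    by (intro adjoint_unique) simp
  then have "transpose (matrix c) = matrix c"
    using matrix_adjoint[OF lin] by simp
  moreover have "invertible (matrix c)"
  proof -
    have "(c has_derivative c) (at 0)"
      by (intro bounded_linear_imp_has_derivative) (simp add: lin flip: linear_conv_bounded_linear)
    then have "frechet_derivative c (at 0) = c"
      using frechet_derivative_at by metis
    \<comment> \<open>The Jacobian is the matrix of the Frechet derivative, and a linear map is its
      own derivative.\<close>
    then have "jacobian (\<lambda>q. v (x, 0, q)) (at 0) = matrix c"
      by (simp add: vc jacobian_def)
    then show ?thesis
      using assms(2) by (metis normal_velocity_def)
  qed
  ultimately show "\<exists>V. transpose V = V \<and> invertible V \<and> (\<forall>F p. v (x, F, p) = V *v p)"
    using vc mat by metis
qed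

end
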